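(* Let $\varepsilon>0$ and $\tilde\varepsilon=\varepsilon/G$, and fix $x\in\mathbf{R}^d$. Consider a stochastic algorithm for minimizing $\eta\mapsto\mathcal{L}_\zeta(x,\eta)$ over $\eta\in\mathbf{R}$ which, for each $\zeta\sim\mathbb{P}$, outputs a random $\eta_x^{\tilde d}(\zeta)\in\mathbf{R}$ satisfying $$\mathbb{E}_{\eta_x^{\tilde d}(\zeta)}\big|\nabla_2\mathcal{L}_\zeta(x,\eta_x^{\tilde d}(\zeta))\big|^2\le\tilde\varepsilon^2 .$$ Then $$\big\|\nabla\Psi_\zeta(x)-\mathbb{E}_{\eta_x^{\tilde d}(\zeta)}\big[\nabla_1\mathcal{L}_\zeta(x,\eta_x^{\tilde d}(\zeta))\big]\big\|^2\le\varepsilon^2,\qquad\forall\,\zeta\sim\mathbb{P}.$$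
   Context: Setting. $\mathbb{P}$ is the nominal distribution of $\zeta$ on a sample space $\Omega$, $\nu$ is a reference probability measure on $\Omega$ from which $\xi$ is sampled (independently of $\zeta$), $\lambda,\beta>0$, $\ell(x;\xi)$ is a real-valued loss ($x\in\mathbf{R}^d$, $\xi\in\Omega$), $c:\Omega\times\Omega\to\mathbf{R}$ is a cost. The function $f:[0,\infty)\to[-\infty,+\infty]$ is convex with $f(1)=0$ and $f(0)=\lim_{t\to0+}f(t)$, with conjugate $f^*(v)=\sup_{r\ge0}\{vr-f(r)\}$. Define $$\mathcal{L}_\zeta(x,\eta)=\mathbb{E}_{\xi\sim\nu}\Big[\lambda\beta f^*\Big(\frac{\ell(x;\xi)-\lambda c(\zeta,\xi)-\eta}{\lambda\beta}\Big)\Big]+\eta,\qquad \Psi_\zeta(x)=\min_{\eta\in\mathbf{R}}\mathcal{L}_\zeta(x,\eta),$$ where the minimum is attained at some $\eta_x^*(\zeta)$. $\nabla_1,\nabla_2$ denote gradients in $x$ and $\eta$, given by $$\nabla_1\mathcal{L}_\zeta(x,\eta)=\mathbb{E}_{\xi\sim\nu}\big[(f^* )'(u)\nabla\ell(x;\xi)\big],\quad \nabla_2\mathcal{L}_\zeta(x,\eta)=1-\mathbb{E}_{\xi\sim\nu}[(f^* )'(u)],\quad u=\tfrac{\ell(x;\xi)-\lambda c(\zeta,\xi)-\eta}{\lambda\beta}.$$ $\nabla\Psi_\zeta$ is the gradient in $x$; $\mathbb{E}_{\eta_x^{\tilde d}(\zeta)}$ is expectation over the randomness of the algorithm's output. Standing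 assumption: for every $\xi$, $\ell(\cdot;\xi)$ is $G$-Lipschitz continuous, continuously differentiable and $L$-smooth (its gradient is $L$-Lipschitz); $f^*$ is continuously differentiable and $M$-smooth (its derivative is $M$-Lipschitz); and $x\mapsto\mathbb{E}_{\zeta\sim\mathbb{P}}[\Psi_\zeta(x)]$ is bounded below. *)

theory Defs
  imports "HOL-Probability.Probability"
begin

text \<open>
  The gradient is specified only where the function is differentiable; there the
  vector is unique.
\<close>

definition grad :: "('a::euclidean_space \<Rightarrow> real) \<Rightarrow> 'a \<Rightarrow> 'a" where
  "grad g x = (THE D. GDERIV g x :> D)"

text \<open>
  A function \<open>f\<close> from \<open>[0,\<infinity>)\<close> to \<open>[-\<infinity>,\<infinity>]\<close> is represented by a function on all reals whose
  values at negative arguments are never used. Convexity is convexity of the epigraph,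
  which avoids expressions of the form \<open>\<infinity> - \<infinity>\<close>.
\<close>

definition ereal_convex :: "(real \<Rightarrow> ereal) \<Rightarrow> bool" where
  "ereal_convex f \<longleftrightarrow> convex {(t, y :: real). 0 \<le> t \<and> f t \<le> ereal y}"

definition econj :: "(real \<Rightarrow> ereal) \<Rightarrow> real \<Rightarrow> ereal" where
  "econj f v = (SUP r\<in>{0..}. ereal (v * r) - f r)"

text \<open>The real-valued version agrees with \<open>econj\<close> where the latter is finite.\<close>

definition rconj :: "(real \<Rightarrow> ereal) \<Rightarrow> real \<Rightarrow> real" where
  "rconj f v = real_of_ereal (econj f v)"

definition dual_obj ::
  "'w measure \<Rightarrow> real \<Rightarrow> real \<Rightarrow> (real \<Rightarrow> ereal) \<Rightarrow> ('a \<Rightarrow> 'w \<Rightarrow> real) \<Rightarrow> ('w \<Rightarrow> 'w \<Rightarrow> real)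
    \<Rightarrow> 'w \<Rightarrow> 'a \<Rightarrow> real \<Rightarrow> real" where
  "dual_obj \<nu> lam \<beta> f l c \<zeta> x \<eta> =
     (\<integral>\<xi>. lam * \<beta> * rconj f ((l x \<xi> - lam * c \<zeta> \<xi> - \<eta>) / (lam * \<beta>)) \<partial>\<nu>) + \<eta>"

text \<open>The infimum is used below only when it is attained, i.e. is a minimum.\<close>

definition Psi ::
  "'w measure \<Rightarrow> real \<Rightarrow> real \<Rightarrow> (real \<Rightarrow> ereal) \<Rightarrow> ('a \<Rightarrow> 'w \<Rightarrow> real) \<Rightarrow> ('w \<Rightarrow> 'w \<Rightarrow> real)
    \<Rightarrow> 'w \<Rightarrow> 'a \<Rightarrow> real" where
  "Psi \<nu> lam \<beta> f l c \<zeta> x = (INF \<eta>. dual_obj \<nu> lam \<beta> f l c \<zeta> x \<eta>)"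

definition grad1 ::
  "'w measure \<Rightarrow> real \<Rightarrow> real \<Rightarrow> (real \<Rightarrow> ereal) \<Rightarrow> ('a::euclidean_space \<Rightarrow> 'w \<Rightarrow> real)
    \<Rightarrow> ('w \<Rightarrow> 'w \<Rightarrow> real) \<Rightarrow> 'w \<Rightarrow> 'a \<Rightarrow> real \<Rightarrow> 'a" where
  "grad1 \<nu> lam \<beta> f l c \<zeta> x \<eta> = grad (\<lambda>y. dual_obj \<nu> lam \<beta> f l c \<zeta> y \<eta>) x"

definition grad2 ::
  "'w measure \<Rightarrow> real \<Rightarrow> real \<Rightarrow> (real \<Rightarrow> ereal) \<Rightarrow> ('a \<Rightarrow> 'w \<Rightarrow> real)
    \<Rightarrow> ('w \<Rightarrow> 'w \<Rightarrow> real) \<Rightarrow> 'w \<Rightarrow> 'a \<Rightarrow> real \<Rightarrow> real" where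
  "grad2 \<nu> lam \<beta> f l c \<zeta> x \<eta> = deriv (\<lambda>t. dual_obj \<nu> lam \<beta> f l c \<zeta> x t) \<eta>"

end

theory Submission
  imports Defs
begin

text \<open>
  Put \<open>h = f\<^sup>*\<close>, \<open>s = \<lambda>\<beta>\<close> and let \<open>u\<close> be the argument of \<open>f\<^sup>*\<close> in the dual objective
  \<open>F(y, \<eta>)\<close>. As a supremum of affine functions of slope \<open>r \<ge> 0\<close>, \<open>h\<close> is convex and
  nondecreasing, so \<open>h'(u) \<ge> 0\<close> acts as a weight on the sample space. With its total mass
  \<open>p(\<eta>) = E[h'(u)]\<close> and the weighted loss gradient \<open>g(\<eta>) = E[h'(u) \<nabla>\<ell>]\<close>, the two partial
  gradients of \<open>F\<close> are \<open>g\<close> and \<open>1 - p\<close>.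

  The gradient of \<open>\<Psi>\<close> exists although the minimiser in \<open>\<eta>\<close> need not be unique. The tangent
  inequality for \<open>h\<close>, taken jointly in \<open>(y, \<theta>)\<close> at \<open>(x, \<eta>)\<close>, bounds \<open>F(y, \<theta>)\<close> from below by its
  first-order expansion up to an error \<open>O(|y - x|\<^sup>2)\<close> that does not involve \<open>\<theta>\<close>
  (\<open>F_lower\<close>). If \<open>\<eta>\<close> minimises \<open>F(x, \<cdot>)\<close> then \<open>p(\<eta>) = 1\<close>, the expansion loses its dependence on
  \<open>\<theta>\<close>, and minimising over \<open>\<theta>\<close> bounds \<open>\<Psi>(y)\<close> from below. The Lipschitz bound for \<open>h'\<close> bounds
  \<open>\<Psi>(y) \<le> F(y, \<eta>)\<close> from above to the same order (\<open>F_upper\<close>). Hence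
  \<open>\<nabla>\<Psi>(x) = g(\<eta>)\<close> (\<open>GDERIV_marginal\<close>). The argument never follows a minimiser as \<open>y\<close> varies.

  The bias is then controlled by monotonicity of \<open>h'\<close>. Changing \<open>\<eta>\<close> to \<open>\<theta>\<close> shifts \<open>u\<close> by the same
  constant at every sample point, so \<open>h'(u)\<close> changes with the same sign everywhere and the
  \<open>L\<^sup>1\<close> norm of the change is \<open>|p(\<eta>) - p(\<theta>)|\<close>. As \<open>|\<nabla>\<ell>| \<le> G\<close>, this gives
  \<open>|g(\<eta>) - g(\<theta>)| \<le> G |p(\<eta>) - p(\<theta>)|\<close> (\<open>norm_wgrad_diff_le\<close>), and for a minimiser \<open>\<eta>\<close> the right
  side is \<open>G\<close> times the size of the gradient of \<open>F(x, \<cdot>)\<close> at \<open>\<theta>\<close>. Averaging over the output of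
  the algorithm and bounding the first absolute moment by the second gives \<open>G \<cdot> \<epsilon> / G = \<epsilon>\<close>.
\<close>

section \<open>Derivatives and second moments\<close>

lemma has_derivative_of_quadratic_bound:
  fixes F :: "'a::real_normed_vector \<Rightarrow> real"
  assumes D: "bounded_linear D"
    and bound: "\<And>y. \<bar>F y - F x - D (y - x)\<bar> \<le> K * (norm (y - x))\<^sup>2"
  shows "(F has_derivative D) (at x)"
  unfolding has_derivative_at2
proof (intro conjI D)
  have "((\<lambda>y. K * norm (y - x)) \<longlongrightarrow> K * norm (x - x)) (at x)"
    by (intro tendsto_intros)
  then have lim: "((\<lambda>y. K * norm (y - x)) \<longlongrightarrow> 0) (at x)" by simp
  have ev: "eventually (\<lambda>y. norm ((1 / norm (y - x)) *\<^sub>R (F y - (F x + D (y - x)))) \<le> K * norm (y - x)) (at x)"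
  proof (rule eventually_mono[OF eventually_neq_at_within[of x x UNIV]])
    fix y assume "y \<noteq> x"
    then have pos: "norm (y - x) > 0" by simp
    have "\<bar>F y - (F x + D (y - x))\<bar> / norm (y - x) \<le> K * (norm (y - x))\<^sup>2 / norm (y - x)"
      using bound[of y] by (intro divide_right_mono) (auto simp: algebra_simps)
    also have "\<dots> = K * norm (y - x)" using pos by (simp add: power2_eq_square)
    finally show "norm ((1 / norm (y - x)) *\<^sub>R (F y - (F x + D (y - x)))) \<le> K * norm (y - x)"
      by simp
  qed
  show "((\<lambda>y. (1 / norm (y - x)) *\<^sub>R (F y - (F x + D (y - x)))) \<longlongrightarrow> 0) (at x)"
    by (rule Lim_null_comparison[OF ev lim])
qed

lemma GDERIV_unique:
  assumes "GDERIV g x :> D" and "GDERIV g x :> E"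
  shows "D = E"
proof -
  have "(\<lambda>h. h \<bullet> D) = (\<lambda>h. h \<bullet> E)"
    using assms unfolding gderiv_def by (rule has_derivative_unique)
  then have "(D - E) \<bullet> D = (D - E) \<bullet> E" by metis
  then have "(D - E) \<bullet> (D - E) = 0" by (simp add: inner_diff_right)
  then show ?thesis by simp
qed

lemma grad_eq: "GDERIV g x :> D \<Longrightarrow> grad g x = D"
  unfolding grad_def by (blast intro: GDERIV_unique)

lemma GDERIV_grad:
  fixes g :: "'a::euclidean_space \<Rightarrow> real"
  assumes "g differentiable (at x)"
  shows "GDERIV g x :> grad g x"
proof -
  obtain D where D: "(g has_derivative D) (at x)" using assms by (auto simp: differentiable_def)
  then interpret bounded_linear D by (rule has_derivative_bounded_linear)
  have "D h = h \<bullet> (\<Sum>b\<in>Basis. D b *\<^sub>R b)" for h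
  proof -
    have "D h = D (\<Sum>b\<in>Basis. (h \<bullet> b) *\<^sub>R b)" by (simp add: euclidean_representation)
    also have "\<dots> = (\<Sum>b\<in>Basis. (h \<bullet> b) * D b)" by (simp add: sum scaleR)
    also have "\<dots> = h \<bullet> (\<Sum>b\<in>Basis. D b *\<^sub>R b)"
      by (simp add: inner_sum_right mult.commute)
    finally show ?thesis .
  qed
  then have "GDERIV g x :> (\<Sum>b\<in>Basis. D b *\<^sub>R b)"
    unfolding gderiv_def using D by (metis (no_types, lifting) ext)
  then show ?thesis using grad_eq by metis
qed

text \<open>
  The difference quotients of \<open>g\<close> along \<open>D\<close> are at most \<open>G |D|\<close> and converge to \<open>D \<bullet> D\<close>.
\<close>

lemma norm_GDERIV_le_lipschitz:
  fixes g :: "'a::real_inner \<Rightarrow> real"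
  assumes g: "GDERIV g x :> D" and lip: "G-lipschitz_on UNIV g"
  shows "norm D \<le> G"
proof -
  have "((\<lambda>t. g (x + t *\<^sub>R D)) has_derivative (\<lambda>t. (t *\<^sub>R D) \<bullet> D)) (at 0)"
    using g unfolding gderiv_def
    by (intro has_derivative_compose[where g = g and f = "\<lambda>t. x + t *\<^sub>R D"])
       (auto intro!: derivative_eq_intros)
  then have "((\<lambda>t. g (x + t *\<^sub>R D)) has_real_derivative (D \<bullet> D)) (at 0)"
    unfolding has_field_derivative_def
    by (rule has_derivative_eq_rhs) (simp add: fun_eq_iff mult.commute)
  then have "((\<lambda>t. (g (x + t *\<^sub>R D) - g x) / t) \<longlongrightarrow> D \<bullet> D) (at 0)"
    by (simp add: DERIV_def)
  moreover have "eventually (\<lambda>t. (g (x + t *\<^sub>R D) - g x) / t \<le> G * norm D) (at 0)"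
  proof (rule eventually_mono[OF eventually_neq_at_within[of 0 0 UNIV]])
    fix t :: real assume t: "t \<noteq> 0"
    have "\<bar>g (x + t *\<^sub>R D) - g x\<bar> \<le> G * (\<bar>t\<bar> * norm D)"
      using lipschitz_onD[OF lip, of "x + t *\<^sub>R D" x] by (simp add: dist_norm)
    then have "\<bar>(g (x + t *\<^sub>R D) - g x) / t\<bar> \<le> G * norm D"
      using t by (simp add: abs_divide divide_le_eq algebra_simps)
    then show "(g (x + t *\<^sub>R D) - g x) / t \<le> G * norm D" by linarith
  qed
  ultimately have "D \<bullet> D \<le> G * norm D" by (rule tendsto_upperbound) simp
  then show ?thesis
    using lipschitz_on_nonneg[OF lip]
    by (cases "norm D = 0") (auto simp: dot_square_norm power2_eq_square)
qed

text \<open>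
  The mean value inequality for \<open>g - g'(x)\<close> on the ball around \<open>x\<close> through \<open>y\<close>. The constant is
  \<open>L\<close> and not \<open>L / 2\<close>: only the order of the error matters below.
\<close>

lemma abs_linearisation_error_le:
  fixes g :: "'a::euclidean_space \<Rightarrow> real"
  assumes g: "\<And>y. GDERIV g y :> g' y" and lip: "L-lipschitz_on UNIV g'"
  shows "\<bar>g y - g x - (y - x) \<bullet> g' x\<bar> \<le> L * (norm (y - x))\<^sup>2"
proof -
  have "norm (g y - g x - (y - x) \<bullet> g' x) \<le> norm (y - x) * (L * norm (y - x))"
  proof (rule differentiable_bound_linearization[where S = "cball x (norm (y - x))" and ?x0.0 = x
        and f' = "\<lambda>z h. h \<bullet> g' z"])
    show "x + t *\<^sub>R (y - x) \<in> cball x (norm (y - x))" if "t \<in> {0..1}" for t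
      using that by (auto simp: dist_norm mult_left_le_one_le)
    show "(g has_derivative (\<lambda>h. h \<bullet> g' z)) (at z within cball x (norm (y - x)))" for z
      using g[of z] unfolding gderiv_def by (rule has_derivative_at_withinI)
    show "onorm ((\<lambda>h. h \<bullet> g' z) - (\<lambda>h. h \<bullet> g' x)) \<le> L * norm (y - x)"
      if "z \<in> cball x (norm (y - x))" for z
    proof (rule onorm_bound)
      show nn: "0 \<le> L * norm (y - x)" using lipschitz_on_nonneg[OF lip] by simp
      have "norm (g' z - g' x) \<le> L * dist z x"
        using lipschitz_onD[OF lip, of z x] by (simp add: dist_norm)
      also have "\<dots> \<le> L * norm (y - x)"
        using that lipschitz_on_nonneg[OF lip] by (auto simp: dist_commute intro: mult_left_mono)
      finally have B: "norm (g' z - g' x) \<le> L * norm (y - x)" .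
      fix h
      have "norm (((\<lambda>h. h \<bullet> g' z) - (\<lambda>h. h \<bullet> g' x)) h) = \<bar>h \<bullet> (g' z - g' x)\<bar>"
        by (simp add: inner_diff_right)
      also have "\<dots> \<le> norm h * norm (g' z - g' x)" by (rule Cauchy_Schwarz_ineq2)
      also have "\<dots> \<le> norm h * (L * norm (y - x))" by (intro mult_left_mono B) simp
      finally show "norm (((\<lambda>h. h \<bullet> g' z) - (\<lambda>h. h \<bullet> g' x)) h) \<le> L * norm (y - x) * norm h"
        by (simp add: mult.commute)
    qed
    show "x \<in> cball x (norm (y - x))" by simp
  qed
  then show ?thesis by (simp add: power2_eq_square algebra_simps)
qed

lemma norm_integral_le_integral:
  fixes f :: "'a \<Rightarrow> 'b::{banach, second_countable_topology}"
  assumes f: "integrable M f" and g: "integrable M g"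
    and le: "\<And>x. x \<in> space M \<Longrightarrow> norm (f x) \<le> g x"
  shows "norm (\<integral>x. f x \<partial>M) \<le> (\<integral>x. g x \<partial>M)"
proof -
  have "norm (\<integral>x. f x \<partial>M) \<le> (\<integral>x. norm (f x) \<partial>M)" by (rule integral_norm_bound)
  also have "\<dots> \<le> (\<integral>x. g x \<partial>M)" using f g le by (intro integral_mono integrable_norm)
  finally show ?thesis .
qed

text \<open>
  Jensen's inequality in the form that the variance of \<open>|X|\<close> is nonnegative.
\<close>

lemma (in prob_space) expectation_abs_le_of_second_moment:
  fixes X :: "'a \<Rightarrow> real"
  assumes X: "X \<in> borel_measurable M" and "0 \<le> e"
    and second: "(\<integral>\<^sup>+\<omega>. ennreal (\<bar>X \<omega>\<bar>\<^sup>2) \<partial>M) \<le> ennreal (e\<^sup>2)"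
  shows "integrable M X" and "expectation (\<lambda>\<omega>. \<bar>X \<omega>\<bar>) \<le> e"
proof -
  have sq: "integrable M (\<lambda>\<omega>. (X \<omega>)\<^sup>2)"
  proof (rule integrableI_bounded)
    have "(\<integral>\<^sup>+\<omega>. ennreal (norm ((X \<omega>)\<^sup>2)) \<partial>M) \<le> ennreal (e\<^sup>2)" using second by simp
    also have "\<dots> < \<infinity>" by simp
    finally show "(\<integral>\<^sup>+\<omega>. ennreal (norm ((X \<omega>)\<^sup>2)) \<partial>M) < \<infinity>" .
  qed (use X in measurable)
  show int: "integrable M X" by (rule square_integrable_imp_integrable[OF X sq])
  have "ennreal (expectation (\<lambda>\<omega>. (X \<omega>)\<^sup>2)) \<le> ennreal (e\<^sup>2)"
    using second by (simp add: nn_integral_eq_integral[OF sq, symmetric])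
  then have "expectation (\<lambda>\<omega>. (X \<omega>)\<^sup>2) \<le> e\<^sup>2" by simp
  moreover have "0 \<le> variance (\<lambda>\<omega>. \<bar>X \<omega>\<bar>)" by (rule variance_positive)
  moreover have "variance (\<lambda>\<omega>. \<bar>X \<omega>\<bar>)
      = expectation (\<lambda>\<omega>. \<bar>X \<omega>\<bar>\<^sup>2) - (expectation (\<lambda>\<omega>. \<bar>X \<omega>\<bar>))\<^sup>2"
    using sq int by (intro variance_eq) auto
  ultimately have "(expectation (\<lambda>\<omega>. \<bar>X \<omega>\<bar>))\<^sup>2 \<le> e\<^sup>2" by simp
  then show "expectation (\<lambda>\<omega>. \<bar>X \<omega>\<bar>) \<le> e" using \<open>0 \<le> e\<close> by (rule power2_le_imp_le)
qed

section \<open>Conjugates over the half-line\<close>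

text \<open>
  Finiteness of the conjugate excludes the value \<open>-\<infinity>\<close> of \<open>f\<close> on \<open>[0,\<infinity>)\<close>, and points with value
  \<open>\<infinity>\<close> do not affect the supremum. So the real-valued conjugate is the least upper bound of the
  affine functions that come from finite values of \<open>f\<close>; these two lemmas say this, and spare all
  later arguments the extended reals.
\<close>

lemma rconj_upper:
  assumes fin: "\<And>v. \<bar>econj f v\<bar> \<noteq> \<infinity>" and "r \<ge> 0" and "f r = ereal a"
  shows "v * r - a \<le> rconj f v"
proof -
  have "ereal (v * r) - f r \<le> econj f v"
    unfolding econj_def using \<open>r \<ge> 0\<close> by (intro SUP_upper) auto
  also have "\<dots> = ereal (rconj f v)" unfolding rconj_def using fin by (simp add: ereal_real')
  finally show ?thesis using \<open>f r = ereal a\<close> by simp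
qed

lemma rconj_least:
  assumes fin: "\<And>v. \<bar>econj f v\<bar> \<noteq> \<infinity>"
    and le: "\<And>r a. r \<ge> 0 \<Longrightarrow> f r = ereal a \<Longrightarrow> v * r - a \<le> B"
  shows "rconj f v \<le> B"
proof -
  have "ereal (v * r) - f r \<le> ereal B" if r: "r \<in> {0..}" for r
  proof (cases "f r")
    case (real a) then show ?thesis using le[of r a] r by simp
  next
    case PInf then show ?thesis by simp
  next
    case MInf
    have "ereal (v * r) - f r \<le> econj f v"
      unfolding econj_def using r by (intro SUP_upper) auto
    then show ?thesis using fin[of v] MInf by simp
  qed
  then have "econj f v \<le> ereal B" unfolding econj_def by (intro SUP_least)
  moreover have "econj f v = ereal (rconj f v)" unfolding rconj_def using fin by (simp add: ereal_real')
  ultimately show ?thesis by simp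
qed

text \<open>
  The slopes \<open>r\<close> are nonnegative because the supremum ranges over the half-line only.
\<close>

lemma mono_rconj:
  assumes fin: "\<And>v. \<bar>econj f v\<bar> \<noteq> \<infinity>"
  shows "mono (rconj f)"
proof
  fix v w :: real assume "v \<le> w"
  show "rconj f v \<le> rconj f w"
  proof (rule rconj_least[OF fin])
    fix r a assume ra: "r \<ge> 0" "f r = ereal a"
    have "v * r - a \<le> w * r - a" using \<open>v \<le> w\<close> ra(1) by (simp add: mult_right_mono)
    also have "\<dots> \<le> rconj f w" by (rule rconj_upper[OF fin ra])
    finally show "v * r - a \<le> rconj f w" .
  qed
qed

lemma convex_rconj:
  assumes fin: "\<And>v. \<bar>econj f v\<bar> \<noteq> \<infinity>"
  shows "convex_on UNIV (rconj f)"
proof (rule convex_onI)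
  fix t v w :: real assume t: "0 < t" "t < 1"
  show "rconj f ((1 - t) *\<^sub>R v + t *\<^sub>R w) \<le> (1 - t) * rconj f v + t * rconj f w"
  proof (rule rconj_least[OF fin])
    fix r a assume ra: "r \<ge> 0" "f r = ereal a"
    have "((1 - t) *\<^sub>R v + t *\<^sub>R w) * r - a = (1 - t) * (v * r - a) + t * (w * r - a)"
      by (simp add: algebra_simps)
    also have "\<dots> \<le> (1 - t) * rconj f v + t * rconj f w"
      using t rconj_upper[OF fin ra] by (intro add_mono mult_left_mono) auto
    finally show "((1 - t) *\<^sub>R v + t *\<^sub>R w) * r - a \<le> (1 - t) * rconj f v + t * rconj f w" .
  qed
qed simp

section \<open>The dual objective for a smooth convex penalty\<close>

text \<open>
  One sample \<open>\<zeta>\<close> of the nominal distribution is fixed here: \<open>h\<close> stands for the conjugate, \<open>s\<close> for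
  \<open>\<lambda>\<beta>\<close> and \<open>k\<close> for \<open>\<lambda> c(\<zeta>, \<cdot>)\<close>. In this abstract form \<open>h\<close> is any nondecreasing convex function with
  Lipschitz derivative \<open>h'\<close>.
\<close>

locale smooth_dual = prob_space \<nu> for \<nu> :: "'w measure" +
  fixes s G L M :: real
    and h h' :: "real \<Rightarrow> real"
    and l :: "'a::euclidean_space \<Rightarrow> 'w \<Rightarrow> real"
    and l' :: "'a \<Rightarrow> 'w \<Rightarrow> 'a"
    and k :: "'w \<Rightarrow> real"
  assumes s_pos: "s > 0"
    and h_convex: "convex_on UNIV h"
    and h_mono: "mono h"
    and h_deriv: "\<And>v. (h has_real_derivative h' v) (at v)"
    and h'_lipschitz: "M-lipschitz_on UNIV h'"
    and l_meas: "\<And>y. l y \<in> borel_measurable \<nu>"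
    and k_meas: "k \<in> borel_measurable \<nu>"
    and l_lipschitz: "\<And>\<xi>. \<xi> \<in> space \<nu> \<Longrightarrow> G-lipschitz_on UNIV (\<lambda>y. l y \<xi>)"
    and l_GDERIV: "\<And>\<xi> y. \<xi> \<in> space \<nu> \<Longrightarrow> GDERIV (\<lambda>y. l y \<xi>) y :> l' y \<xi>"
    and l'_lipschitz: "\<And>\<xi>. \<xi> \<in> space \<nu> \<Longrightarrow> L-lipschitz_on UNIV (\<lambda>y. l' y \<xi>)"
    and h_integrable: "\<And>y \<eta>. integrable \<nu> (\<lambda>\<xi>. h ((l y \<xi> - k \<xi> - \<eta>) / s))"
begin

abbreviation u :: "'a \<Rightarrow> real \<Rightarrow> 'w \<Rightarrow> real" where
  "u y \<eta> \<xi> \<equiv> (l y \<xi> - k \<xi> - \<eta>) / s"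

definition F :: "'a \<Rightarrow> real \<Rightarrow> real" where
  "F y \<eta> = (\<integral>\<xi>. s * h (u y \<eta> \<xi>) \<partial>\<nu>) + \<eta>"

text \<open>
  The weight \<open>h'(u)\<close> is the density, up to normalisation, of the adversarial distribution relative
  to \<open>\<nu>\<close>. The dual variable \<open>\<eta>\<close> is the multiplier of the constraint that the mass is \<open>1\<close>.
\<close>

definition mass :: "'a \<Rightarrow> real \<Rightarrow> real" where
  "mass y \<eta> = (\<integral>\<xi>. h' (u y \<eta> \<xi>) \<partial>\<nu>)"

definition wgrad :: "'a \<Rightarrow> real \<Rightarrow> 'a" where
  "wgrad y \<eta> = (\<integral>\<xi>. h' (u y \<eta> \<xi>) *\<^sub>R l' y \<xi> \<partial>\<nu>)"

lemma h_ge_tangent: "h v + h' v * (w - v) \<le> h w"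
  using convex_on_imp_above_tangent[OF h_convex, of v w "h' v"] h_deriv[of v] by auto

lemma h'_mono: "v \<le> w \<Longrightarrow> h' v \<le> h' w"
proof (rule ccontr)
  assume "v \<le> w" "\<not> h' v \<le> h' w"
  then have "v < w" and "h' w < h' v" by (auto simp: le_less)
  then have "0 < (h' v - h' w) * (w - v)" by simp
  then show False
    using h_ge_tangent[of v w] h_ge_tangent[of w v] by (simp add: algebra_simps)
qed

lemma h'_nonneg: "0 \<le> h' v"
  using h_ge_tangent[of v "v - 1"] monoD[OF h_mono, of "v - 1" v] by simp

lemma M_nonneg: "0 \<le> M"
  using h'_lipschitz by (rule lipschitz_on_nonneg)

lemma abs_h'_diff_le: "\<bar>h' v - h' w\<bar> \<le> M * \<bar>v - w\<bar>"
  using lipschitz_onD[OF h'_lipschitz, of v w] by (simp add: dist_real_def)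

lemma h_le_tangent: "h w \<le> h v + h' v * (w - v) + M * (w - v)\<^sup>2"
proof -
  have "(h' w - h' v) * (w - v) \<le> \<bar>h' w - h' v\<bar> * \<bar>w - v\<bar>"
    by (metis abs_ge_self abs_mult)
  also have "\<dots> \<le> M * \<bar>w - v\<bar> * \<bar>w - v\<bar>" by (intro mult_right_mono abs_h'_diff_le) simp
  finally have "(h' w - h' v) * (w - v) \<le> M * (w - v)\<^sup>2"
    by (simp add: power2_eq_square mult.assoc)
  then show ?thesis using h_ge_tangent[of w v] by (simp add: algebra_simps)
qed

lemma h'_measurable [measurable]: "h' \<in> borel_measurable borel"
  using lipschitz_on_continuous_on[OF h'_lipschitz]
  by (simp add: borel_measurable_continuous_onI)

lemmas [measurable] = l_meas k_meas

text \<open>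
  Convexity dominates the weight by an increment of \<open>h\<close>: \<open>0 \<le> h'(v) \<le> h(v + 1) - h(v)\<close>. Lowering
  \<open>\<eta>\<close> by \<open>s\<close> raises \<open>u\<close> by exactly \<open>1\<close>, so the increment is a difference of two integrable
  functions.
\<close>

lemma integrable_weight: "integrable \<nu> (\<lambda>\<xi>. h' (u y \<eta> \<xi>))"
proof (rule Bochner_Integration.integrable_bound)
  show "integrable \<nu> (\<lambda>\<xi>. h (u y (\<eta> - s) \<xi>) - h (u y \<eta> \<xi>))"
    by (intro Bochner_Integration.integrable_diff h_integrable)
  show "AE \<xi> in \<nu>. norm (h' (u y \<eta> \<xi>)) \<le> norm (h (u y (\<eta> - s) \<xi>) - h (u y \<eta> \<xi>))"
  proof (rule AE_I2)
    fix \<xi>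
    have "u y (\<eta> - s) \<xi> = u y \<eta> \<xi> + 1" using s_pos by (simp add: field_simps)
    then show "norm (h' (u y \<eta> \<xi>)) \<le> norm (h (u y (\<eta> - s) \<xi>) - h (u y \<eta> \<xi>))"
      using h_ge_tangent[of "u y \<eta> \<xi>" "u y \<eta> \<xi> + 1"] h'_nonneg[of "u y \<eta> \<xi>"] by simp
  qed
qed measurable

lemma G_nonneg: "0 \<le> G"
  using not_empty l_lipschitz lipschitz_on_nonneg by blast

lemma abs_l_diff_le: "\<xi> \<in> space \<nu> \<Longrightarrow> \<bar>l y \<xi> - l x \<xi>\<bar> \<le> G * norm (y - x)"
  using lipschitz_onD[OF l_lipschitz, of \<xi> y x] by (simp add: dist_norm)

lemma norm_l'_le: "\<xi> \<in> space \<nu> \<Longrightarrow> norm (l' y \<xi>) \<le> G"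
  using norm_GDERIV_le_lipschitz l_GDERIV l_lipschitz by blast

lemma l_linearisation:
  "\<xi> \<in> space \<nu> \<Longrightarrow> \<bar>l y \<xi> - l x \<xi> - (y - x) \<bullet> l' x \<xi>\<bar> \<le> L * (norm (y - x))\<^sup>2"
  using abs_linearisation_error_le[of "\<lambda>y. l y \<xi>" "\<lambda>y. l' y \<xi>"] l_GDERIV l'_lipschitz by blast

text \<open>
  Each component of the gradient is the limit of difference quotients along a fixed null sequence,
  which are measurable in \<open>\<xi>\<close>.
\<close>

lemma l'_measurable [measurable]: "l' y \<in> borel_measurable \<nu>"
proof (subst borel_measurable_euclidean_space, intro ballI)
  fix b :: 'a assume b: "b \<in> Basis"
  define t :: "nat \<Rightarrow> real" where "t n = 1 / real (Suc n)" for n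
  have t0: "t \<longlonglongrightarrow> 0" unfolding t_def using LIMSEQ_inverse_real_of_nat by (simp add: inverse_eq_divide)
  have tpos: "t n > 0" for n unfolding t_def by simp
  show "(\<lambda>\<xi>. l' y \<xi> \<bullet> b) \<in> borel_measurable \<nu>"
  proof (rule borel_measurable_LIMSEQ_real)
    show "(\<lambda>\<xi>. (l (y + t n *\<^sub>R b) \<xi> - l y \<xi>) / t n) \<in> borel_measurable \<nu>" for n
      by measurable
    fix \<xi> assume \<xi>: "\<xi> \<in> space \<nu>"
    have lim: "(\<lambda>n. L * t n) \<longlonglongrightarrow> 0" using tendsto_mult_left[OF t0, of L] by simp
    have "\<forall>n. norm ((l (y + t n *\<^sub>R b) \<xi> - l y \<xi>) / t n - l' y \<xi> \<bullet> b) \<le> L * t n"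
    proof
      fix n
      have "\<bar>l (y + t n *\<^sub>R b) \<xi> - l y \<xi> - t n * (l' y \<xi> \<bullet> b)\<bar> \<le> L * t n * t n"
        using l_linearisation[OF \<xi>, of "y + t n *\<^sub>R b" y] b
        by (simp add: inner_commute power2_eq_square mult.assoc)
      then have "\<bar>l (y + t n *\<^sub>R b) \<xi> - l y \<xi> - t n * (l' y \<xi> \<bullet> b)\<bar> / t n \<le> L * t n"
        using tpos[of n] by (simp add: divide_le_eq)
      moreover have "(l (y + t n *\<^sub>R b) \<xi> - l y \<xi>) / t n - l' y \<xi> \<bullet> b
          = (l (y + t n *\<^sub>R b) \<xi> - l y \<xi> - t n * (l' y \<xi> \<bullet> b)) / t n"
        using tpos[of n] by (simp add: field_simps)
      ultimately show "norm ((l (y + t n *\<^sub>R b) \<xi> - l y \<xi>) / t n - l' y \<xi> \<bullet> b) \<le> L * t n"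
        using tpos[of n] by simp
    qed
    then have "(\<lambda>n. (l (y + t n *\<^sub>R b) \<xi> - l y \<xi>) / t n - l' y \<xi> \<bullet> b) \<longlonglongrightarrow> 0"
      by (intro Lim_null_comparison[OF always_eventually lim])
    then show "(\<lambda>n. (l (y + t n *\<^sub>R b) \<xi> - l y \<xi>) / t n) \<longlonglongrightarrow> l' y \<xi> \<bullet> b"
      by (simp add: LIM_zero_iff)
  qed
qed

lemma integrable_weighted_loss_diff: "integrable \<nu> (\<lambda>\<xi>. h' (u x \<eta> \<xi>) * (l y \<xi> - l x \<xi>))"
proof (rule Bochner_Integration.integrable_bound)
  show "integrable \<nu> (\<lambda>\<xi>. h' (u x \<eta> \<xi>) * (G * norm (y - x)))"
    using integrable_weight by simp
  show "AE \<xi> in \<nu>. norm (h' (u x \<eta> \<xi>) * (l y \<xi> - l x \<xi>))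
      \<le> norm (h' (u x \<eta> \<xi>) * (G * norm (y - x)))"
    using abs_l_diff_le G_nonneg
    by (intro AE_I2) (simp add: abs_mult mult_left_mono)
qed measurable

lemma integrable_weighted_grad: "integrable \<nu> (\<lambda>\<xi>. h' (u y \<eta> \<xi>) *\<^sub>R l' y \<xi>)"
proof (rule Bochner_Integration.integrable_bound)
  show "integrable \<nu> (\<lambda>\<xi>. h' (u y \<eta> \<xi>) * G)" using integrable_weight by simp
  show "AE \<xi> in \<nu>. norm (h' (u y \<eta> \<xi>) *\<^sub>R l' y \<xi>) \<le> norm (h' (u y \<eta> \<xi>) * G)"
    using norm_l'_le G_nonneg by (intro AE_I2) (simp add: abs_mult mult_left_mono)
qed measurable

lemma weighted_loss_diff_linearisation:
  "\<bar>(\<integral>\<xi>. h' (u x \<eta> \<xi>) * (l y \<xi> - l x \<xi>) \<partial>\<nu>) - (y - x) \<bullet> wgrad x \<eta>\<bar>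
     \<le> L * mass x \<eta> * (norm (y - x))\<^sup>2"
proof -
  let ?w = "\<lambda>\<xi>. h' (u x \<eta> \<xi>)"
  have "(y - x) \<bullet> wgrad x \<eta> = (\<integral>\<xi>. (y - x) \<bullet> (?w \<xi> *\<^sub>R l' x \<xi>) \<partial>\<nu>)"
    unfolding wgrad_def using integrable_weighted_grad by (simp only: integral_inner_left integral_inner_right)
  moreover have "integrable \<nu> (\<lambda>\<xi>. (y - x) \<bullet> (?w \<xi> *\<^sub>R l' x \<xi>))"
    using integrable_weighted_grad by (intro integrable_inner_right)
  ultimately have "(\<integral>\<xi>. ?w \<xi> * (l y \<xi> - l x \<xi>) \<partial>\<nu>) - (y - x) \<bullet> wgrad x \<eta>
      = (\<integral>\<xi>. ?w \<xi> * (l y \<xi> - l x \<xi>) - (y - x) \<bullet> (?w \<xi> *\<^sub>R l' x \<xi>) \<partial>\<nu>)"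
    using integrable_weighted_loss_diff by simp
  also have "norm \<dots> \<le> (\<integral>\<xi>. ?w \<xi> * (L * (norm (y - x))\<^sup>2) \<partial>\<nu>)"
  proof (rule norm_integral_le_integral)
    show "integrable \<nu> (\<lambda>\<xi>. ?w \<xi> * (l y \<xi> - l x \<xi>) - (y - x) \<bullet> (?w \<xi> *\<^sub>R l' x \<xi>))"
      using integrable_weighted_loss_diff integrable_weighted_grad
      by (intro Bochner_Integration.integrable_diff integrable_inner_right)
    show "integrable \<nu> (\<lambda>\<xi>. ?w \<xi> * (L * (norm (y - x))\<^sup>2))" using integrable_weight by simp
    fix \<xi> assume \<xi>: "\<xi> \<in> space \<nu>"
    have "?w \<xi> * (l y \<xi> - l x \<xi>) - (y - x) \<bullet> (?w \<xi> *\<^sub>R l' x \<xi>)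
        = ?w \<xi> * (l y \<xi> - l x \<xi> - (y - x) \<bullet> l' x \<xi>)" by (simp add: algebra_simps)
    then show "norm (?w \<xi> * (l y \<xi> - l x \<xi>) - (y - x) \<bullet> (?w \<xi> *\<^sub>R l' x \<xi>))
        \<le> ?w \<xi> * (L * (norm (y - x))\<^sup>2)"
      using l_linearisation[OF \<xi>, of y x] h'_nonneg by (simp add: abs_mult mult_left_mono)
  qed
  finally show ?thesis by (simp add: mass_def algebra_simps)
qed

text \<open>
  The integrand is \<open>s\<close> times the tangent to \<open>h\<close> at \<open>u x \<eta> \<xi>\<close>, evaluated at \<open>u y \<theta> \<xi>\<close>.
\<close>

lemma integral_tangent:
  "integrable \<nu> (\<lambda>\<xi>. s * h (u x \<eta> \<xi>) + h' (u x \<eta> \<xi>) * (l y \<xi> - l x \<xi> - (\<theta> - \<eta>)))"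
  "(\<integral>\<xi>. s * h (u x \<eta> \<xi>) + h' (u x \<eta> \<xi>) * (l y \<xi> - l x \<xi> - (\<theta> - \<eta>)) \<partial>\<nu>)
     = F x \<eta> - \<eta> + (\<integral>\<xi>. h' (u x \<eta> \<xi>) * (l y \<xi> - l x \<xi>) \<partial>\<nu>) - (\<theta> - \<eta>) * mass x \<eta>"
proof -
  let ?w = "\<lambda>\<xi>. h' (u x \<eta> \<xi>)"
  have eq: "(\<lambda>\<xi>. s * h (u x \<eta> \<xi>) + ?w \<xi> * (l y \<xi> - l x \<xi> - (\<theta> - \<eta>)))
      = (\<lambda>\<xi>. s * h (u x \<eta> \<xi>) + ?w \<xi> * (l y \<xi> - l x \<xi>) - (\<theta> - \<eta>) * ?w \<xi>)"
    by (auto simp: algebra_simps)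
  have I: "integrable \<nu> (\<lambda>\<xi>. s * h (u x \<eta> \<xi>))" "integrable \<nu> (\<lambda>\<xi>. (\<theta> - \<eta>) * ?w \<xi>)"
    using h_integrable integrable_weight by (auto intro: integrable_mult_right)
  show "integrable \<nu> (\<lambda>\<xi>. s * h (u x \<eta> \<xi>) + ?w \<xi> * (l y \<xi> - l x \<xi> - (\<theta> - \<eta>)))"
    unfolding eq using I integrable_weighted_loss_diff
    by (intro Bochner_Integration.integrable_diff Bochner_Integration.integrable_add)
  have "(\<integral>\<xi>. s * h (u x \<eta> \<xi>) + ?w \<xi> * (l y \<xi> - l x \<xi>) - (\<theta> - \<eta>) * ?w \<xi> \<partial>\<nu>)
      = (\<integral>\<xi>. s * h (u x \<eta> \<xi>) \<partial>\<nu>) + (\<integral>\<xi>. ?w \<xi> * (l y \<xi> - l x \<xi>) \<partial>\<nu>) - (\<integral>\<xi>. (\<theta> - \<eta>) * ?w \<xi> \<partial>\<nu>)"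
    by (simp only: Bochner_Integration.integral_diff Bochner_Integration.integral_add
        Bochner_Integration.integrable_add I integrable_weighted_loss_diff)
  then show "(\<integral>\<xi>. s * h (u x \<eta> \<xi>) + ?w \<xi> * (l y \<xi> - l x \<xi> - (\<theta> - \<eta>)) \<partial>\<nu>)
      = F x \<eta> - \<eta> + (\<integral>\<xi>. ?w \<xi> * (l y \<xi> - l x \<xi>) \<partial>\<nu>) - (\<theta> - \<eta>) * mass x \<eta>"
    unfolding eq F_def mass_def by simp
qed

lemma s_times_shift: "s * (u y \<theta> \<xi> - u x \<eta> \<xi>) = l y \<xi> - l x \<xi> - (\<theta> - \<eta>)"
  using s_pos by (simp add: field_simps)

text \<open>
  Convexity of \<open>h\<close> makes the tangent a lower bound with no error in \<open>\<theta>\<close>; the only error comes from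
  linearising the loss in \<open>y\<close>. This one-sided bound, uniform in \<open>\<theta>\<close>, is what survives the infimum
  over \<open>\<theta>\<close>.
\<close>

lemma F_lower:
  "F x \<eta> + (y - x) \<bullet> wgrad x \<eta> + (1 - mass x \<eta>) * (\<theta> - \<eta>) - L * mass x \<eta> * (norm (y - x))\<^sup>2
     \<le> F y \<theta>"
proof -
  have "(\<integral>\<xi>. s * h (u x \<eta> \<xi>) + h' (u x \<eta> \<xi>) * (l y \<xi> - l x \<xi> - (\<theta> - \<eta>)) \<partial>\<nu>)
      \<le> (\<integral>\<xi>. s * h (u y \<theta> \<xi>) \<partial>\<nu>)"
  proof (rule integral_mono[OF integral_tangent(1)])
    show "integrable \<nu> (\<lambda>\<xi>. s * h (u y \<theta> \<xi>))" using h_integrable by simp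
    fix \<xi>
    have "s * (h (u x \<eta> \<xi>) + h' (u x \<eta> \<xi>) * (u y \<theta> \<xi> - u x \<eta> \<xi>)) \<le> s * h (u y \<theta> \<xi>)"
      using s_pos h_ge_tangent by (intro mult_left_mono) auto
    moreover have "s * (h (u x \<eta> \<xi>) + h' (u x \<eta> \<xi>) * (u y \<theta> \<xi> - u x \<eta> \<xi>))
        = s * h (u x \<eta> \<xi>) + h' (u x \<eta> \<xi>) * (s * (u y \<theta> \<xi> - u x \<eta> \<xi>))" by (simp only: algebra_simps)
    ultimately show "s * h (u x \<eta> \<xi>) + h' (u x \<eta> \<xi>) * (l y \<xi> - l x \<xi> - (\<theta> - \<eta>)) \<le> s * h (u y \<theta> \<xi>)"
      by (simp only: s_times_shift)
  qed
  then have "F x \<eta> + (\<integral>\<xi>. h' (u x \<eta> \<xi>) * (l y \<xi> - l x \<xi>) \<partial>\<nu>) + (1 - mass x \<eta>) * (\<theta> - \<eta>) \<le> F y \<theta>"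
    unfolding integral_tangent(2) by (simp add: F_def[of y \<theta>] algebra_simps)
  then show ?thesis using weighted_loss_diff_linearisation[of x \<eta> y] by linarith
qed

text \<open>
  Here the tangent to \<open>h\<close> has an error quadratic in the increment of \<open>u\<close>, whose product with \<open>s\<close>
  is at most \<open>G |y - x| + |\<theta> - \<eta>|\<close> at every sample point.
\<close>

lemma F_upper:
  "F y \<theta> \<le> F x \<eta> + (y - x) \<bullet> wgrad x \<eta> + (1 - mass x \<eta>) * (\<theta> - \<eta>)
     + L * mass x \<eta> * (norm (y - x))\<^sup>2 + M / s * (G * norm (y - x) + \<bar>\<theta> - \<eta>\<bar>)\<^sup>2"
proof -
  define R where "R = G * norm (y - x) + \<bar>\<theta> - \<eta>\<bar>"
  have "(\<integral>\<xi>. s * h (u y \<theta> \<xi>) \<partial>\<nu>)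
      \<le> (\<integral>\<xi>. s * h (u x \<eta> \<xi>) + h' (u x \<eta> \<xi>) * (l y \<xi> - l x \<xi> - (\<theta> - \<eta>)) + M / s * R\<^sup>2 \<partial>\<nu>)"
  proof (rule integral_mono)
    show "integrable \<nu> (\<lambda>\<xi>. s * h (u y \<theta> \<xi>))" using h_integrable by simp
    show "integrable \<nu> (\<lambda>\<xi>. s * h (u x \<eta> \<xi>) + h' (u x \<eta> \<xi>) * (l y \<xi> - l x \<xi> - (\<theta> - \<eta>)) + M / s * R\<^sup>2)"
      by (intro Bochner_Integration.integrable_add integral_tangent(1) integrable_const)
    fix \<xi> assume \<xi>: "\<xi> \<in> space \<nu>"
    define d where "d = u y \<theta> \<xi> - u x \<eta> \<xi>"
    have sd: "s * d = l y \<xi> - l x \<xi> - (\<theta> - \<eta>)" unfolding d_def by (rule s_times_shift)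
    have "\<bar>s * d\<bar> \<le> R" unfolding sd R_def using abs_l_diff_le[OF \<xi>, of y x] by linarith
    then have "(s * d)\<^sup>2 \<le> R\<^sup>2" by (metis abs_ge_zero power2_abs power_mono)
    then have "M / s * (s * d)\<^sup>2 \<le> M / s * R\<^sup>2"
      using M_nonneg s_pos by (intro mult_left_mono) auto
    moreover have "s * h (u y \<theta> \<xi>) \<le> s * (h (u x \<eta> \<xi>) + h' (u x \<eta> \<xi>) * d + M * d\<^sup>2)"
      unfolding d_def using s_pos h_le_tangent by (intro mult_left_mono) auto
    moreover have "s * (h (u x \<eta> \<xi>) + h' (u x \<eta> \<xi>) * d + M * d\<^sup>2)
        = s * h (u x \<eta> \<xi>) + h' (u x \<eta> \<xi>) * (s * d) + M / s * (s * d)\<^sup>2"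
      using s_pos by (simp add: field_simps power2_eq_square)
    ultimately show "s * h (u y \<theta> \<xi>)
        \<le> s * h (u x \<eta> \<xi>) + h' (u x \<eta> \<xi>) * (l y \<xi> - l x \<xi> - (\<theta> - \<eta>)) + M / s * R\<^sup>2"
      unfolding sd by linarith
  qed
  also have "\<dots> = F x \<eta> - \<eta> + (\<integral>\<xi>. h' (u x \<eta> \<xi>) * (l y \<xi> - l x \<xi>) \<partial>\<nu>)
      - (\<theta> - \<eta>) * mass x \<eta> + M / s * R\<^sup>2"
    by (subst Bochner_Integration.integral_add[OF integral_tangent(1) integrable_const])
       (simp only: integral_tangent(2), simp add: prob_space)
  finally have "F y \<theta> \<le> F x \<eta> + (\<integral>\<xi>. h' (u x \<eta> \<xi>) * (l y \<xi> - l x \<xi>) \<partial>\<nu>)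
      + (1 - mass x \<eta>) * (\<theta> - \<eta>) + M / s * R\<^sup>2"
    by (simp add: F_def[of y \<theta>] algebra_simps)
  then show ?thesis
    using weighted_loss_diff_linearisation[of x \<eta> y] unfolding R_def by linarith
qed

text \<open>
  The bounds are those of \<open>F_lower\<close> and \<open>F_upper\<close> with the linear term in \<open>\<theta>\<close> absent. That term
  vanishes both for \<open>F(\<cdot>, \<eta>)\<close>, where \<open>\<theta> = \<eta>\<close>, and for the infimum over \<open>\<theta>\<close>, where the mass is \<open>1\<close>.
\<close>

lemma GDERIV_of_sandwich:
  assumes "\<And>y. \<Phi> x + (y - x) \<bullet> wgrad x \<eta> - L * mass x \<eta> * (norm (y - x))\<^sup>2 \<le> \<Phi> y"
    and "\<And>y. \<Phi> y \<le> \<Phi> x + (y - x) \<bullet> wgrad x \<eta> + L * mass x \<eta> * (norm (y - x))\<^sup>2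
            + M / s * (G * norm (y - x))\<^sup>2"
  shows "GDERIV \<Phi> x :> wgrad x \<eta>"
  unfolding gderiv_def
proof (rule has_derivative_of_quadratic_bound)
  show "bounded_linear (\<lambda>h. h \<bullet> wgrad x \<eta>)" by (rule bounded_linear_inner_left)
  fix y
  have "0 \<le> M / s * (G * norm (y - x))\<^sup>2" using M_nonneg s_pos by simp
  then have "\<bar>\<Phi> y - \<Phi> x - (y - x) \<bullet> wgrad x \<eta>\<bar>
      \<le> L * mass x \<eta> * (norm (y - x))\<^sup>2 + M / s * (G * norm (y - x))\<^sup>2"
    using assms(1)[of y] assms(2)[of y] unfolding abs_le_iff by linarith
  then show "\<bar>\<Phi> y - \<Phi> x - (y - x) \<bullet> wgrad x \<eta>\<bar>
      \<le> (L * mass x \<eta> + M / s * G\<^sup>2) * (norm (y - x))\<^sup>2"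
    by (simp add: power_mult_distrib algebra_simps)
qed

lemma GDERIV_F: "GDERIV (\<lambda>y. F y \<eta>) x :> wgrad x \<eta>"
  using F_lower[of x \<eta> _ \<eta>] F_upper[of _ \<eta> x \<eta>] by (intro GDERIV_of_sandwich) auto

lemma DERIV_F: "(F x has_real_derivative (1 - mass x \<eta>)) (at \<eta>)"
  unfolding has_field_derivative_def
proof (rule has_derivative_of_quadratic_bound)
  show "bounded_linear ((*) (1 - mass x \<eta>))" by (rule bounded_linear_mult_right)
  show "\<bar>F x \<theta> - F x \<eta> - (1 - mass x \<eta>) * (\<theta> - \<eta>)\<bar> \<le> M / s * (norm (\<theta> - \<eta>))\<^sup>2" for \<theta>
    using F_lower[of x \<eta> x \<theta>] F_upper[of x \<theta> x \<eta>] M_nonneg s_pos unfolding abs_le_iff by simp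
qed

lemma mass_eq_1_of_minimum:
  assumes "\<And>\<theta>. F x \<eta> \<le> F x \<theta>"
  shows "mass x \<eta> = 1"
proof -
  have "1 - mass x \<eta> = 0" by (rule DERIV_local_min[OF DERIV_F zero_less_one]) (simp add: assms)
  then show ?thesis by simp
qed

text \<open>
  An envelope theorem without uniqueness of the minimiser: from below, \<open>F_lower\<close> holds for
  all \<open>\<theta>\<close> simultaneously and no longer depends on \<open>\<theta>\<close>, since \<open>\<eta>\<close> has mass \<open>1\<close>; from above,
  \<open>\<eta>\<close> itself is a competitor at every \<open>y\<close>.
\<close>

lemma GDERIV_marginal:
  assumes min: "\<And>\<theta>. F x \<eta> \<le> F x \<theta>"
  shows "GDERIV (\<lambda>y. INF \<theta>. F y \<theta>) x :> wgrad x \<eta>"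
proof (rule GDERIV_of_sandwich)
  have m: "mass x \<eta> = 1" by (rule mass_eq_1_of_minimum[OF min])
  have lower: "F x \<eta> + (y - x) \<bullet> wgrad x \<eta> - L * mass x \<eta> * (norm (y - x))\<^sup>2 \<le> F y \<theta>" for y \<theta>
    using F_lower[of x \<eta> y \<theta>] m by simp
  have bdd: "bdd_below (range (F y))" for y by (rule bdd_belowI2) (rule lower)
  have inf_x: "(INF \<theta>. F x \<theta>) = F x \<eta>" by (rule cInf_eq_minimum) (use min in auto)
  fix y
  show "(INF \<theta>. F x \<theta>) + (y - x) \<bullet> wgrad x \<eta> - L * mass x \<eta> * (norm (y - x))\<^sup>2 \<le> (INF \<theta>. F y \<theta>)"
    unfolding inf_x using lower by (intro cINF_greatest) auto
  have "(INF \<theta>. F y \<theta>) \<le> F y \<eta>" by (rule cINF_lower[OF bdd]) simp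
  also have "\<dots> \<le> F x \<eta> + (y - x) \<bullet> wgrad x \<eta> + L * mass x \<eta> * (norm (y - x))\<^sup>2
      + M / s * (G * norm (y - x))\<^sup>2"
    using F_upper[of y \<eta> x \<eta>] by simp
  finally show "(INF \<theta>. F y \<theta>) \<le> (INF \<theta>. F x \<theta>) + (y - x) \<bullet> wgrad x \<eta>
      + L * mass x \<eta> * (norm (y - x))\<^sup>2 + M / s * (G * norm (y - x))\<^sup>2"
    unfolding inf_x .
qed

text \<open>
  The two arguments of \<open>h'\<close> differ by \<open>(\<theta> - \<eta>) / s\<close>, the same for all \<open>\<xi>\<close>. As \<open>h'\<close> is monotone, the
  difference has constant sign and the absolute value may be moved outside the integral.
\<close>

lemma integral_abs_weight_diff:
  "(\<integral>\<xi>. \<bar>h' (u x \<eta> \<xi>) - h' (u x \<theta> \<xi>)\<bar> \<partial>\<nu>) = \<bar>mass x \<eta> - mass x \<theta>\<bar>"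
proof -
  have ordered: "(\<integral>\<xi>. \<bar>h' (u x a \<xi>) - h' (u x b \<xi>)\<bar> \<partial>\<nu>) = \<bar>mass x a - mass x b\<bar>" if "a \<le> b" for a b
  proof -
    have le: "h' (u x b \<xi>) \<le> h' (u x a \<xi>)" for \<xi>
      using that s_pos by (intro h'_mono divide_right_mono) auto
    then have "(\<integral>\<xi>. \<bar>h' (u x a \<xi>) - h' (u x b \<xi>)\<bar> \<partial>\<nu>) = mass x a - mass x b"
      unfolding mass_def by (simp add: integrable_weight)
    moreover have "mass x b \<le> mass x a"
      unfolding mass_def using le by (intro integral_mono integrable_weight)
    ultimately show ?thesis by simp
  qed
  show ?thesis
  proof (cases "\<eta> \<le> \<theta>")
    case True then show ?thesis by (rule ordered)
  next
    case False
    then show ?thesis using ordered[of \<theta> \<eta>] by (simp add: abs_minus_commute)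
  qed
qed

lemma norm_wgrad_diff_le: "norm (wgrad x \<eta> - wgrad x \<theta>) \<le> G * \<bar>mass x \<eta> - mass x \<theta>\<bar>"
proof -
  let ?d = "\<lambda>\<xi>. h' (u x \<eta> \<xi>) - h' (u x \<theta> \<xi>)"
  have "wgrad x \<eta> - wgrad x \<theta> = (\<integral>\<xi>. ?d \<xi> *\<^sub>R l' x \<xi> \<partial>\<nu>)"
    unfolding wgrad_def by (simp add: integrable_weighted_grad scaleR_diff_left)
  also have "norm \<dots> \<le> (\<integral>\<xi>. G * \<bar>?d \<xi>\<bar> \<partial>\<nu>)"
  proof (rule norm_integral_le_integral)
    show "integrable \<nu> (\<lambda>\<xi>. ?d \<xi> *\<^sub>R l' x \<xi>)"
      by (simp add: integrable_weighted_grad scaleR_diff_left)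
    show "integrable \<nu> (\<lambda>\<xi>. G * \<bar>?d \<xi>\<bar>)" by (simp add: integrable_weight)
    show "norm (?d \<xi> *\<^sub>R l' x \<xi>) \<le> G * \<bar>?d \<xi>\<bar>" if "\<xi> \<in> space \<nu>" for \<xi>
      using norm_l'_le[OF that, of x] by (simp add: mult.commute[of G] mult_left_mono)
  qed
  also have "\<dots> = G * \<bar>mass x \<eta> - mass x \<theta>\<bar>" by (simp add: integral_abs_weight_diff)
  finally show ?thesis .
qed

text \<open>
  Continuity in \<open>\<eta>\<close> makes the partial gradients measurable when they are evaluated at a random \<open>\<eta>\<close>.
\<close>

lemma mass_lipschitz: "(M / s)-lipschitz_on UNIV (mass x)"
proof (rule lipschitz_onI)
  show "0 \<le> M / s" using M_nonneg s_pos by simp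
  fix \<eta> \<theta> :: real
  have "\<bar>mass x \<eta> - mass x \<theta>\<bar> = (\<integral>\<xi>. \<bar>h' (u x \<eta> \<xi>) - h' (u x \<theta> \<xi>)\<bar> \<partial>\<nu>)"
    by (simp add: integral_abs_weight_diff)
  also have "\<dots> \<le> (\<integral>\<xi>. M / s * \<bar>\<eta> - \<theta>\<bar> \<partial>\<nu>)"
  proof (rule integral_mono)
    show "integrable \<nu> (\<lambda>\<xi>. \<bar>h' (u x \<eta> \<xi>) - h' (u x \<theta> \<xi>)\<bar>)" by (simp add: integrable_weight)
    fix \<xi>
    have "u x \<eta> \<xi> - u x \<theta> \<xi> = (\<theta> - \<eta>) / s" by (simp add: diff_divide_distrib)
    then have "\<bar>u x \<eta> \<xi> - u x \<theta> \<xi>\<bar> = \<bar>\<eta> - \<theta>\<bar> / s"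
      using s_pos by (simp add: abs_minus_commute)
    then show "\<bar>h' (u x \<eta> \<xi>) - h' (u x \<theta> \<xi>)\<bar> \<le> M / s * \<bar>\<eta> - \<theta>\<bar>"
      using abs_h'_diff_le[of "u x \<eta> \<xi>" "u x \<theta> \<xi>"] by simp
  qed simp
  finally show "dist (mass x \<eta>) (mass x \<theta>) \<le> M / s * dist \<eta> \<theta>"
    by (simp add: dist_real_def prob_space)
qed

lemma mass_measurable [measurable]: "mass x \<in> borel_measurable borel"
  using lipschitz_on_continuous_on[OF mass_lipschitz] by (rule borel_measurable_continuous_onI)

lemma wgrad_measurable [measurable]: "wgrad x \<in> borel_measurable borel"
proof (rule borel_measurable_continuous_onI, rule lipschitz_on_continuous_on, rule lipschitz_onI)
  show "0 \<le> G * (M / s)" using G_nonneg M_nonneg s_pos by simp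
  fix \<eta> \<theta> :: real
  have "dist (wgrad x \<eta>) (wgrad x \<theta>) \<le> G * \<bar>mass x \<eta> - mass x \<theta>\<bar>"
    unfolding dist_norm by (rule norm_wgrad_diff_le)
  also have "\<dots> \<le> G * (M / s * dist \<eta> \<theta>)"
    using lipschitz_onD[OF mass_lipschitz, of \<eta> \<theta>] G_nonneg
    by (intro mult_left_mono) (auto simp: dist_real_def)
  finally show "dist (wgrad x \<eta>) (wgrad x \<theta>) \<le> G * (M / s) * dist \<eta> \<theta>" by (simp add: mult.assoc)
qed

text \<open>
  The mass at the minimiser is \<open>1\<close>, so \<open>norm_wgrad_diff_le\<close> bounds the pointwise error by \<open>G\<close> times
  the residual gradient in \<open>\<eta>\<close>. The same bound shows that the random gradient is integrable.
\<close>

lemma bias_le: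
  assumes "prob_space Q" and out[measurable]: "out \<in> borel_measurable Q" and "0 \<le> e"
    and min: "\<And>\<theta>. F x \<eta> \<le> F x \<theta>"
    and acc: "(\<integral>\<^sup>+\<omega>. ennreal (\<bar>1 - mass x (out \<omega>)\<bar>\<^sup>2) \<partial>Q) \<le> ennreal (e\<^sup>2)"
  shows "norm (wgrad x \<eta> - (\<integral>\<omega>. wgrad x (out \<omega>) \<partial>Q)) \<le> G * e"
proof -
  interpret Q: prob_space Q by fact
  have m: "mass x \<eta> = 1" by (rule mass_eq_1_of_minimum[OF min])
  have meas: "(\<lambda>\<omega>. 1 - mass x (out \<omega>)) \<in> borel_measurable Q" by measurable
  note second = Q.expectation_abs_le_of_second_moment[OF meas \<open>0 \<le> e\<close> acc]
  have gap: "norm (wgrad x \<eta> - wgrad x (out \<omega>)) \<le> G * \<bar>1 - mass x (out \<omega>)\<bar>" for \<omega>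
    using norm_wgrad_diff_le[of x \<eta> "out \<omega>"] m by simp
  have dom: "integrable Q (\<lambda>\<omega>. G * \<bar>1 - mass x (out \<omega>)\<bar>)" using second(1) by simp
  have int_diff: "integrable Q (\<lambda>\<omega>. wgrad x \<eta> - wgrad x (out \<omega>))"
  proof (rule Bochner_Integration.integrable_bound[OF dom])
    show "AE \<omega> in Q. norm (wgrad x \<eta> - wgrad x (out \<omega>)) \<le> norm (G * \<bar>1 - mass x (out \<omega>)\<bar>)"
      using gap G_nonneg by (simp add: abs_mult)
  qed measurable
  have int_g: "integrable Q (\<lambda>\<omega>. wgrad x (out \<omega>))"
    using Bochner_Integration.integrable_diff[OF Q.integrable_const[of "wgrad x \<eta>"] int_diff] by simp
  have "wgrad x \<eta> - (\<integral>\<omega>. wgrad x (out \<omega>) \<partial>Q) = (\<integral>\<omega>. wgrad x \<eta> - wgrad x (out \<omega>) \<partial>Q)"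
    by (subst Bochner_Integration.integral_diff[OF Q.integrable_const int_g])
       (simp add: Q.prob_space)
  also have "norm \<dots> \<le> (\<integral>\<omega>. G * \<bar>1 - mass x (out \<omega>)\<bar> \<partial>Q)"
    by (rule norm_integral_le_integral[OF int_diff dom gap])
  also have "\<dots> \<le> G * e" using second(2) G_nonneg by (simp add: mult_left_mono)
  finally show ?thesis .
qed

end

section \<open>The bias of the gradient estimate\<close>

theorem theorem7:
  fixes P \<nu> :: "'w measure"
    and Q :: "'s measure"
    and lam \<beta> G L M \<epsilon> :: real
    and f :: "real \<Rightarrow> ereal"
    and l :: "real ^ 'd \<Rightarrow> 'w \<Rightarrow> real"
    and c :: "'w \<Rightarrow> 'w \<Rightarrow> real"
    and x :: "real ^ 'd"
    and out :: "'w \<Rightarrow> 's \<Rightarrow> real"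
  assumes "prob_space P" and "prob_space \<nu>" and "sets \<nu> = sets P"
    and "lam > 0" and "\<beta> > 0"
    and l_meas: "\<And>y. l y \<in> borel_measurable \<nu>"
    and c_meas: "\<And>\<zeta>. \<zeta> \<in> space P \<Longrightarrow> c \<zeta> \<in> borel_measurable \<nu>"
    and f_convex: "ereal_convex f"
    and f_one: "f 1 = 0"
    and f_zero: "(f \<longlongrightarrow> f 0) (at_right 0)"
    and l_lipschitz: "\<And>\<xi>. \<xi> \<in> space \<nu> \<Longrightarrow> G-lipschitz_on UNIV (\<lambda>y. l y \<xi>)"
    and l_diff: "\<And>\<xi> y. \<xi> \<in> space \<nu> \<Longrightarrow> (\<lambda>y. l y \<xi>) differentiable (at y)"
    and l_C1: "\<And>\<xi>. \<xi> \<in> space \<nu> \<Longrightarrow> continuous_on UNIV (grad (\<lambda>y. l y \<xi>))"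
    and l_smooth: "\<And>\<xi>. \<xi> \<in> space \<nu> \<Longrightarrow> L-lipschitz_on UNIV (grad (\<lambda>y. l y \<xi>))"
    and conj_finite: "\<And>v. \<bar>econj f v\<bar> \<noteq> \<infinity>"
    and conj_diff: "\<And>v. rconj f differentiable (at v)"
    and conj_C1: "continuous_on UNIV (deriv (rconj f))"
    and conj_smooth: "M-lipschitz_on UNIV (deriv (rconj f))"
    and obj_integrable: "\<And>\<zeta> y \<eta>. \<zeta> \<in> space P \<Longrightarrow>
      integrable \<nu> (\<lambda>\<xi>. rconj f ((l y \<xi> - lam * c \<zeta> \<xi> - \<eta>) / (lam * \<beta>)))"
    and min_attained: "\<And>\<zeta> y. \<zeta> \<in> space P \<Longrightarrow>
      \<exists>\<eta>. \<forall>t. dual_obj \<nu> lam \<beta> f l c \<zeta> y \<eta> \<le> dual_obj \<nu> lam \<beta> f l c \<zeta> y t"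
    and Psi_integrable: "\<And>y. integrable P (\<lambda>\<zeta>. Psi \<nu> lam \<beta> f l c \<zeta> y)"
    and Psi_bdd_below: "bdd_below (range (\<lambda>y. \<integral>\<zeta>. Psi \<nu> lam \<beta> f l c \<zeta> y \<partial>P))"
    and "G > 0" and "\<epsilon> > 0"
    and "prob_space Q"
    and out_meas: "\<And>\<zeta>. \<zeta> \<in> space P \<Longrightarrow> out \<zeta> \<in> borel_measurable Q"
    and out_accuracy: "\<And>\<zeta>. \<zeta> \<in> space P \<Longrightarrow>
      (\<integral>\<^sup>+\<omega>. ennreal (\<bar>grad2 \<nu> lam \<beta> f l c \<zeta> x (out \<zeta> \<omega>)\<bar>\<^sup>2) \<partial>Q) \<le> ennreal ((\<epsilon> / G)\<^sup>2)"
  shows "\<forall>\<zeta>\<in>space P.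
    (norm (grad (Psi \<nu> lam \<beta> f l c \<zeta>) x
      - (\<integral>\<omega>. grad1 \<nu> lam \<beta> f l c \<zeta> x (out \<zeta> \<omega>) \<partial>Q)))\<^sup>2 \<le> \<epsilon>\<^sup>2"
proof
  fix \<zeta> assume \<zeta>: "\<zeta> \<in> space P"
  interpret \<nu>: prob_space \<nu> by fact
  interpret smooth_dual \<nu> "lam * \<beta>" G L M "rconj f" "deriv (rconj f)" l
    "\<lambda>y \<xi>. grad (\<lambda>y. l y \<xi>) y" "\<lambda>\<xi>. lam * c \<zeta> \<xi>"
  proof unfold_locales
    show "lam * \<beta> > 0" using \<open>lam > 0\<close> \<open>\<beta> > 0\<close> by simp
    show "(rconj f has_real_derivative deriv (rconj f) v) (at v)" for v
      using conj_diff[of v] by (simp add: DERIV_deriv_iff_real_differentiable)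
    show "(\<lambda>\<xi>. lam * c \<zeta> \<xi>) \<in> borel_measurable \<nu>" using c_meas[OF \<zeta>] by simp
    show "GDERIV (\<lambda>y. l y \<xi>) y :> grad (\<lambda>y. l y \<xi>) y" if "\<xi> \<in> space \<nu>" for \<xi> y
      using l_diff[OF that] by (rule GDERIV_grad)
  qed (use convex_rconj[OF conj_finite] mono_rconj[OF conj_finite] conj_smooth l_meas
      l_lipschitz l_smooth obj_integrable[OF \<zeta>] in auto)
  have F_eq: "dual_obj \<nu> lam \<beta> f l c \<zeta> = F"
    by (intro ext) (simp add: dual_obj_def F_def)
  have grad1_eq: "grad1 \<nu> lam \<beta> f l c \<zeta> x \<eta> = wgrad x \<eta>" for \<eta>
    unfolding grad1_def F_eq by (rule grad_eq[OF GDERIV_F])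
  have grad2_eq: "grad2 \<nu> lam \<beta> f l c \<zeta> x \<eta> = 1 - mass x \<eta>" for \<eta>
    unfolding grad2_def F_eq by (rule DERIV_imp_deriv[OF DERIV_F])
  obtain \<eta> where min: "\<And>\<theta>. F x \<eta> \<le> F x \<theta>"
    using min_attained[OF \<zeta>, of x] unfolding F_eq by blast
  have "Psi \<nu> lam \<beta> f l c \<zeta> = (\<lambda>y. INF \<theta>. F y \<theta>)"
    by (intro ext) (simp add: Psi_def F_eq)
  then have Psi_eq: "grad (Psi \<nu> lam \<beta> f l c \<zeta>) x = wgrad x \<eta>"
    using grad_eq[OF GDERIV_marginal[OF min]] by simp
  have "norm (wgrad x \<eta> - (\<integral>\<omega>. wgrad x (out \<zeta> \<omega>) \<partial>Q)) \<le> G * (\<epsilon> / G)"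
    using out_accuracy[OF \<zeta>] \<open>G > 0\<close> \<open>\<epsilon> > 0\<close> unfolding grad2_eq
    by (intro bias_le[OF \<open>prob_space Q\<close> out_meas[OF \<zeta>] _ min]) auto
  then have "norm (wgrad x \<eta> - (\<integral>\<omega>. wgrad x (out \<zeta> \<omega>) \<partial>Q)) \<le> \<epsilon>"
    using \<open>G > 0\<close> by simp
  then show "(norm (grad (Psi \<nu> lam \<beta> f l c \<zeta>) x
      - (\<integral>\<omega>. grad1 \<nu> lam \<beta> f l c \<zeta> x (out \<zeta> \<omega>) \<partial>Q)))\<^sup>2 \<le> \<epsilon>\<^sup>2"
    unfolding Psi_eq grad1_eq by (intro power_mono) auto
qed

end
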